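(* Let $G$ be a torsion-free abelian group of finite rank. Then $G$ contains a subgroup of finite index which is a direct sum of strongly indecomposable groups, each of which is a pure subgroup of $G$.
   Context: Torsion-free abelian groups of finite rank are regarded as finite rank additive subgroups of $V=\mathbb{Q}^{\mathbb{N}}$. Two such groups $H,K$ are quasi-equal, written $H\,\dot=\,K$, if there are positive integers $m,n$ with $mH\leq K$ and $nK\leq H$. A quasi-decomposition of $G$ is a quasi-equality $G\,\dot=\,\bigoplus_i A_i$. A non-zero group $G$ is strongly indecomposable if it has no proper quasi-decomposition, i.e. $G$ is not quasi-equal to $H\oplus K$ with $H,K$ non-zero subgroups of $V$. *)

theory Defs
  imports Complex_Main "HOL-Library.Function_Algebras" "HOL-Algebra.Coset"
begin

definition QN :: "(nat \<Rightarrow> rat) monoid" where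
  "QN = \<lparr>carrier = UNIV, monoid.mult = (+), one = 0\<rparr>"

definition scaleQN :: "rat \<Rightarrow> (nat \<Rightarrow> rat) \<Rightarrow> (nat \<Rightarrow> rat)" where
  "scaleQN r v = (\<lambda>i. r * v i)"

global_interpretation QN: vector_space scaleQN
  by unfold_locales (auto simp: scaleQN_def fun_eq_iff algebra_simps)

(* The set B is a maximal linearly independent subset of H.  For subsets of a rational vector
   space, independence over the integers and over the rationals coincide. *)
definition finite_rank :: "(nat \<Rightarrow> rat) set \<Rightarrow> bool" where
  "finite_rank H \<longleftrightarrow> (\<exists>B \<subseteq> H. finite B \<and> QN.independent B \<and> H \<subseteq> QN.span B)"

definition multiples :: "nat \<Rightarrow> (nat \<Rightarrow> rat) set \<Rightarrow> (nat \<Rightarrow> rat) set" where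
  "multiples n H = scaleQN (of_nat n) ` H"

definition quasi_equal :: "(nat \<Rightarrow> rat) set \<Rightarrow> (nat \<Rightarrow> rat) set \<Rightarrow> bool" where
  "quasi_equal H K \<longleftrightarrow> (\<exists>m>0. \<exists>n>0. multiples m H \<subseteq> K \<and> multiples n K \<subseteq> H)"

(* Internal direct sum of a finite family: each element of D is uniquely a sum of elements of
   the A i.  The empty family has direct sum {0}. *)
definition is_direct_sum ::
    "'i set \<Rightarrow> ('i \<Rightarrow> (nat \<Rightarrow> rat) set) \<Rightarrow> (nat \<Rightarrow> rat) set \<Rightarrow> bool" where
  "is_direct_sum I A D \<longleftrightarrow>
     finite I \<and> (\<forall>i\<in>I. subgroup (A i) QN) \<and>
     bij_betw (\<lambda>x. \<Sum>i\<in>I. x i) (\<Pi>\<^sub>E i\<in>I. A i) D"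

(* A sum H <#> K of subgroups is direct iff H and K meet in 0.  Summands of a group quasi-equal
   to G automatically have finite rank, so this is not demanded of H and K. *)
definition strongly_indecomposable :: "(nat \<Rightarrow> rat) set \<Rightarrow> bool" where
  "strongly_indecomposable G \<longleftrightarrow>
     subgroup G QN \<and> finite_rank G \<and> G \<noteq> {0} \<and>
     \<not> (\<exists>H K. subgroup H QN \<and> subgroup K QN \<and> H \<noteq> {0} \<and> K \<noteq> {0} \<and>
              H \<inter> K = {0} \<and> quasi_equal G (H <#>\<^bsub>QN\<^esub> K))"

definition pure_subgroup :: "(nat \<Rightarrow> rat) set \<Rightarrow> (nat \<Rightarrow> rat) set \<Rightarrow> bool" where
  "pure_subgroup A G \<longleftrightarrow>
     subgroup A (QN\<lparr>carrier := G\<rparr>) \<and>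
     (\<forall>n>0. A \<inter> multiples n G = multiples n A)"

definition finite_index_subgroup :: "(nat \<Rightarrow> rat) set \<Rightarrow> (nat \<Rightarrow> rat) set \<Rightarrow> bool" where
  "finite_index_subgroup D G \<longleftrightarrow>
     subgroup D (QN\<lparr>carrier := G\<rparr>) \<and> finite (rcosets\<^bsub>QN\<lparr>carrier := G\<rparr>\<^esub> D)"

end

theory Submission
  imports Defs
begin

text \<open>
  If \<open>G\<close> is non-zero and not strongly indecomposable, some \<open>H \<oplus> K\<close> is quasi-equal to it.  The
  summands need not lie in \<open>G\<close>, but they can be replaced by their purifications
  \<open>H\<^sup>* = {g \<in> G. n g \<in> H for some n > 0}\<close> and \<open>K\<^sup>*\<close>: these are pure in \<open>G\<close>, still meet in \<open>0\<close>
  because no group here has torsion, and \<open>H\<^sup>* \<oplus> K\<^sup>*\<close> contains \<open>N G\<close> for some \<open>N > 0\<close>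
  (\<open>pure_splitting\<close>).  A non-zero element of \<open>K\<^sup>*\<close> is outside the rational span of \<open>H\<^sup>*\<close>, so
  both have smaller rank than \<open>G\<close>.  As purity is transitive, recursion on the rank gives a direct
  sum of pure strongly indecomposable subgroups of \<open>G\<close> that contains \<open>N G\<close> for some \<open>N > 0\<close>
  (\<open>quasi_decomposition\<close>).

  Containing \<open>N G\<close> is all that the recursion records about the size of the sum.  Finite index follows
  from it at the end, since \<open>G / N G\<close> is finite for torsion-free \<open>G\<close> of finite rank
  (\<open>finite_mod_multiples\<close>).  That in turn is an induction on the rank: a coordinate
  that is not identically zero on \<open>G\<close> maps \<open>G\<close> onto a subgroup of \<open>\<rat>\<close>, with kernel of smaller rank,
  and a subgroup of \<open>\<rat>\<close> has at most \<open>N\<close> classes modulo \<open>N\<close> because its finite subsets lie in cyclic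
  subgroups.
\<close>

section \<open>Subgroups of the rational vector space\<close>

lemma group_QN: "group QN"
proof (rule groupI)
  fix x assume "x \<in> carrier QN"
  show "\<exists>y\<in>carrier QN. y \<otimes>\<^bsub>QN\<^esub> x = \<one>\<^bsub>QN\<^esub>"
    by (rule bexI[of _ "- x"]) (auto simp: QN_def)
qed (auto simp: QN_def add.assoc)

lemma inv_QN: "inv\<^bsub>QN\<^esub> x = - x"
proof -
  interpret group QN by (rule group_QN)
  show ?thesis by (rule inv_equality) (auto simp: QN_def)
qed

lemma subgroup_QN_iff:
  "subgroup H QN \<longleftrightarrow> 0 \<in> H \<and> (\<forall>x\<in>H. \<forall>y\<in>H. x + y \<in> H) \<and> (\<forall>x\<in>H. - x \<in> H)"
proof
  assume H: "subgroup H QN"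
  show "0 \<in> H \<and> (\<forall>x\<in>H. \<forall>y\<in>H. x + y \<in> H) \<and> (\<forall>x\<in>H. - x \<in> H)"
    using subgroup.one_closed[OF H] subgroup.m_closed[OF H] subgroup.m_inv_closed[OF H]
    by (auto simp: inv_QN) (auto simp: QN_def)
next
  assume "0 \<in> H \<and> (\<forall>x\<in>H. \<forall>y\<in>H. x + y \<in> H) \<and> (\<forall>x\<in>H. - x \<in> H)"
  then show "subgroup H QN"
    by (intro subgroup.intro) (auto simp: inv_QN, auto simp: QN_def)
qed

lemma
  assumes "subgroup H QN"
  shows subgroup_zero: "0 \<in> H"
    and subgroup_add: "x \<in> H \<Longrightarrow> y \<in> H \<Longrightarrow> x + y \<in> H"
    and subgroup_uminus: "x \<in> H \<Longrightarrow> - x \<in> H"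
    and subgroup_diff: "x \<in> H \<Longrightarrow> y \<in> H \<Longrightarrow> x - y \<in> H"
proof -
  show "0 \<in> H" "x \<in> H \<Longrightarrow> y \<in> H \<Longrightarrow> x + y \<in> H" "x \<in> H \<Longrightarrow> - x \<in> H" for x y
    using assms by (auto simp: subgroup_QN_iff)
  from this(2)[of x "- y"] this(3)[of y] show "x \<in> H \<Longrightarrow> y \<in> H \<Longrightarrow> x - y \<in> H" by simp
qed

lemma subgroup_scale_nat:
  assumes "subgroup H QN" "x \<in> H"
  shows "scaleQN (of_nat n) x \<in> H"
proof (induction n)
  case 0
  have "scaleQN (of_nat 0) x = 0" by simp
  then show ?case using subgroup_zero[OF assms(1)] by (simp only:)
next
  case (Suc n)
  have "scaleQN (of_nat (Suc n)) x = x + scaleQN (of_nat n) x"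
    by (simp add: QN.scale_left_distrib)
  then show ?case
    using subgroup_add[OF assms Suc.IH] by (simp only:)
qed

lemma subgroup_scale_int:
  assumes "subgroup H QN" "x \<in> H"
  shows "scaleQN (of_int z) x \<in> H"
proof (cases z rule: int_cases2)
  case (nonneg n)
  then show ?thesis using subgroup_scale_nat[OF assms, of n] by simp
next
  case (nonpos n)
  then show ?thesis
    using subgroup_uminus[OF assms(1) subgroup_scale_nat[OF assms, of n]] by simp
qed

lemma subgroup_sum:
  assumes "subgroup H QN" "\<And>i. i \<in> I \<Longrightarrow> f i \<in> H"
  shows "sum f I \<in> H"
  using assms(2)
  by (induction I rule: infinite_finite_induct)
    (auto intro: subgroup_zero[OF assms(1)] subgroup_add[OF assms(1)])

lemma subgroup_restrict:
  assumes "subgroup G QN" "subgroup A QN" "A \<subseteq> G"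
  shows "subgroup A (QN\<lparr>carrier := G\<rparr>)"
  using group.subgroup_incl[OF group_QN] assms by blast

lemma subgroup_unrestrict:
  assumes "subgroup G QN" "subgroup A (QN\<lparr>carrier := G\<rparr>)"
  shows "subgroup A QN" "A \<subseteq> G"
  using group.incl_subgroup[OF group_QN assms] subgroup.subset[OF assms(2)] by auto

text \<open>
  Clearing denominators turns a rational combination into an integral one.  This is how
  subgroups that meet in \<open>0\<close> are seen to have spans that meet in \<open>0\<close>.
\<close>

lemma span_multiple_in_subgroup:
  assumes A: "subgroup A QN" and "x \<in> QN.span A"
  shows "\<exists>n::nat. n > 0 \<and> scaleQN (of_nat n) x \<in> A"
  using assms(2)
proof (induction rule: QN.span_induct_alt)
  case base
  have "scaleQN (of_nat 1) 0 \<in> A"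
    using subgroup_zero[OF A] by (simp only: QN.scale_zero_right)
  then show ?case by blast
next
  case (step c x y)
  then obtain n :: nat where n: "n > 0" "scaleQN (of_nat n) y \<in> A" by blast
  obtain a b where ab: "quotient_of c = (a, b)" by force
  have b: "b > 0" and c: "c = of_int a / of_int b"
    using quotient_of_denom_pos[OF ab] quotient_of_div[OF ab] by auto
  have "scaleQN (of_nat (n * nat b)) (scaleQN c x + y) =
      scaleQN (of_int (int n * a)) x + scaleQN (of_int b) (scaleQN (of_nat n) y)"
    using b by (auto simp: c scaleQN_def fun_eq_iff field_simps)
  also have "\<dots> \<in> A"
    by (intro subgroup_add[OF A] subgroup_scale_int[OF A] step n)
  finally have "scaleQN (of_nat (n * nat b)) (scaleQN c x + y) \<in> A" .
  moreover have "n * nat b > 0" using n b by simp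
  ultimately show ?case by blast
qed

section \<open>Rank bounds\<close>

text \<open>
  An upper bound on all independent subsets passes to subsets of \<open>G\<close> without choosing new bases,
  and it is a natural number to induct on.
\<close>

definition rank_le :: "nat \<Rightarrow> (nat \<Rightarrow> rat) set \<Rightarrow> bool" where
  "rank_le r G \<longleftrightarrow> (\<forall>S\<subseteq>G. QN.independent S \<longrightarrow> finite S \<and> card S \<le> r)"

lemma finite_rank_iff_rank_le: "finite_rank G \<longleftrightarrow> (\<exists>r. rank_le r G)"
proof
  assume "finite_rank G"
  then obtain B where "finite B" "G \<subseteq> QN.span B"
    by (auto simp: finite_rank_def)
  then have "rank_le (card B) G"
    unfolding rank_le_def using QN.independent_span_bound[of B] by blast
  then show "\<exists>r. rank_le r G" ..
next
  assume "\<exists>r. rank_le r G"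
  moreover obtain B where "B \<subseteq> G" "QN.independent B" "G \<subseteq> QN.span B"
    using QN.maximal_independent_subset[of G] by blast
  ultimately show "finite_rank G"
    unfolding finite_rank_def rank_le_def by blast
qed

text \<open>
  An independent subset of \<open>H\<close> stays independent when \<open>g\<close> is added to it.  Both inductions on the
  rank descend by this step.
\<close>

lemma rank_le_decrease:
  assumes "rank_le (Suc r) G" "H \<subseteq> G" "g \<in> G" "g \<notin> QN.span H"
  shows "rank_le r H"
  unfolding rank_le_def
proof (intro allI impI)
  fix S assume S: "S \<subseteq> H" "QN.independent S"
  then have g: "g \<notin> QN.span S" using assms(4) QN.span_mono by blast
  then have ins: "QN.independent (insert g S)" and "g \<notin> S"
    using S QN.span_base by (auto simp: QN.independent_insert)
  have "insert g S \<subseteq> G" using S assms by auto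
  with ins assms(1) have "finite (insert g S) \<and> card (insert g S) \<le> Suc r"
    unfolding rank_le_def by (elim allE[of _ "insert g S"]) simp
  then show "finite S \<and> card S \<le> r" using \<open>g \<notin> S\<close>
    by (auto simp: card_insert_disjoint)
qed

lemma rank_le_0:
  assumes "rank_le 0 G" "x \<in> G"
  shows "x = 0"
proof (rule ccontr)
  assume "x \<noteq> 0"
  then have "QN.independent {x}" by simp
  then have "card {x} \<le> 0" using assms unfolding rank_le_def by blast
  then show False by simp
qed

section \<open>Finiteness modulo multiples\<close>

text \<open>
  Two fractions over a common denominator \<open>D\<close> generate the cyclic group of the multiples of
  \<open>gcd X Y / D\<close>, where \<open>X\<close> and \<open>Y\<close> are the numerators; the Bezout identity puts this
  generator into \<open>A\<close>.
\<close>

lemma rat_common_divisor: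
  fixes A :: "rat set"
  assumes zero: "0 \<in> A"
    and comb: "\<And>a b u v. a \<in> A \<Longrightarrow> b \<in> A \<Longrightarrow> of_int u * a + of_int v * b \<in> A"
    and F: "finite F" "F \<subseteq> A"
  shows "\<exists>c\<in>A. \<forall>f\<in>F. \<exists>z. f = of_int z * c"
  using F
proof (induction F rule: finite_induct)
  case empty
  then show ?case using zero by blast
next
  case (insert a F)
  then obtain c where c: "c \<in> A" "\<forall>f\<in>F. \<exists>z. f = of_int z * c" by auto
  obtain x d where xd: "quotient_of a = (x, d)" by force
  obtain y e where ye: "quotient_of c = (y, e)" by force
  define D X Y where "D = d * e" and "X = x * e" and "Y = y * d"
  have D: "D > 0" and aX: "a = of_int X / of_int D" and cY: "c = of_int Y / of_int D"
    using quotient_of_denom_pos[OF xd] quotient_of_div[OF xd]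
      quotient_of_denom_pos[OF ye] quotient_of_div[OF ye]
    by (auto simp: D_def X_def Y_def)
  obtain u v where uv: "u * X + v * Y = gcd X Y" using bezout_int by blast
  define b where "b = of_int u * a + of_int v * c"
  have b: "b = of_int (gcd X Y) / of_int D"
    unfolding b_def aX cY uv[symmetric] by (simp add: add_divide_distrib)
  obtain i j where i: "X = gcd X Y * i" and j: "Y = gcd X Y * j"
    by (meson dvdE gcd_dvd1 gcd_dvd2)
  have ai: "a = of_int i * b"
    unfolding b aX by (subst i) simp
  have cj: "c = of_int j * b"
    unfolding b cY by (subst j) simp
  have "\<exists>z. f = of_int z * b" if "f \<in> insert a F" for f
  proof (cases "f = a")
    case True
    then show ?thesis using ai by blast
  next
    case False
    then have "f \<in> F" using that by simp
    then obtain z where "f = of_int z * c" using c(2) by blast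
    then have "f = of_int (z * j) * b" using cj by simp
    then show ?thesis by blast
  qed
  moreover have "b \<in> A" unfolding b_def using comb insert.prems c by auto
  ultimately show ?case by blast
qed

text \<open>
  Finitely many elements of \<open>A\<close> are multiples \<open>z\<^sub>f c\<close> of one \<open>c \<in> A\<close>, and those with equal
  \<open>z\<^sub>f mod N\<close> are congruent modulo \<open>N A\<close>.  So at most \<open>N\<close> elements are pairwise incongruent, and a
  largest set of such elements represents all classes.
\<close>

lemma rat_finite_mod:
  fixes A :: "rat set" and N :: nat
  assumes zero: "0 \<in> A"
    and comb: "\<And>a b u v. a \<in> A \<Longrightarrow> b \<in> A \<Longrightarrow> of_int u * a + of_int v * b \<in> A"
    and N: "N > 0"
  shows "\<exists>F\<subseteq>A. finite F \<and> (\<forall>a\<in>A. \<exists>f\<in>F. \<exists>x\<in>A. a = f + of_nat N * x)"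
proof -
  define P where "P F \<longleftrightarrow> F \<subseteq> A \<and> finite F \<and>
    (\<forall>f\<in>F. \<forall>g\<in>F. (\<exists>x\<in>A. f = g + of_nat N * x) \<longrightarrow> f = g)" for F
  have bound: "card F \<le> N" if "P F" for F
  proof -
    have F: "F \<subseteq> A" "finite F" using that by (auto simp: P_def)
    obtain c where c: "c \<in> A" "\<forall>f\<in>F. \<exists>z. f = of_int z * c"
      using rat_common_divisor[OF zero comb F(2,1)] by blast
    then obtain z where z: "\<And>f. f \<in> F \<Longrightarrow> f = of_int (z f) * c" by metis
    have "inj_on (\<lambda>f. z f mod int N) F"
    proof (rule inj_onI)
      fix f g assume fg: "f \<in> F" "g \<in> F" "z f mod int N = z g mod int N"
      then obtain k where k: "z f = z g + int N * k"
        by (metis mod_eqE)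
      have "f = g + of_nat N * (of_int k * c)"
        using z[OF fg(1)] z[OF fg(2)] k by (metis (no_types, lifting) distrib_right mult.assoc of_int_add of_int_mult of_int_of_nat_eq)
      moreover have "of_int k * c \<in> A" using comb[OF c(1) zero, of k 0] by simp
      ultimately show "f = g" using that fg unfolding P_def by blast
    qed
    moreover have "(\<lambda>f. z f mod int N) ` F \<subseteq> {0..<int N}" using N by auto
    ultimately have "card F \<le> card {0..<int N}" by (intro card_inj_on_le) auto
    then show ?thesis by simp
  qed
  have "P {}" by (simp add: P_def)
  then obtain F where F: "P F" and maxF: "\<And>F'. P F' \<Longrightarrow> card F' \<le> card F"
    using ex_has_greatest_nat[of P "{}" card "Suc N"] bound by (meson less_Suc_eq_le)
  have "\<exists>f\<in>F. \<exists>x\<in>A. a = f + of_nat N * x" if a: "a \<in> A" for a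
  proof (rule ccontr)
    assume no: "\<not> ?thesis"
    have neg: "- x \<in> A" if "x \<in> A" for x using comb[OF that zero, of "-1" 0] by simp
    have "a \<notin> F" using no zero by force
    moreover have "P (insert a F)"
      unfolding P_def
    proof (intro conjI ballI impI)
      fix f g assume fg: "f \<in> insert a F" "g \<in> insert a F" "\<exists>x\<in>A. f = g + of_nat N * x"
      then obtain x where x: "x \<in> A" "f = g + of_nat N * x" by blast
      then have x': "g = f + of_nat N * (- x)" by simp
      consider "f = a" "g = a" | "f = a" "g \<in> F" | "f \<in> F" "g = a" | "f \<in> F" "g \<in> F"
        using fg by blast
      then show "f = g"
      proof cases
        case 2
        then show ?thesis using no x by blast
      next
        case 3
        then show ?thesis using no x' neg[OF x(1)] by blast
      next
        case 4
        then show ?thesis using F fg(3) by (simp add: P_def)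
      qed simp
    qed (use F a in \<open>auto simp: P_def\<close>)
    ultimately show False using maxF[of "insert a F"] F by (simp add: P_def)
  qed
  then show ?thesis using F unfolding P_def by blast
qed

text \<open>
  The representatives are sums of representatives for the image and for the kernel of a coordinate
  projection: subtracting \<open>f + N x\<close> with the right value at the coordinate \<open>i\<close> moves \<open>g\<close> into the
  kernel, to which the induction hypothesis applies.
\<close>

lemma finite_mod_multiples:
  assumes "subgroup G QN" "rank_le r G" and N: "(N::nat) > 0"
  shows "\<exists>F\<subseteq>G. finite F \<and> (\<forall>g\<in>G. \<exists>f\<in>F. \<exists>x\<in>G. g = f + scaleQN (of_nat N) x)"
  using assms(1,2)
proof (induction r arbitrary: G)
  case 0
  have "0 \<in> G" using subgroup_zero 0 by blast
  moreover have "g = 0 + scaleQN (of_nat N) 0" if "g \<in> G" for g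
    using rank_le_0[OF 0(2) that] by (simp only: QN.scale_zero_right add_0_right)
  ultimately show ?case by blast
next
  case (Suc r)
  note G = \<open>subgroup G QN\<close>
  show ?case
  proof (cases "G = {0}")
    case True
    moreover have "0 = 0 + scaleQN (of_nat N) 0" by simp
    ultimately show ?thesis by blast
  next
    case False
    then obtain g0 where g0: "g0 \<in> G" "g0 \<noteq> 0" using subgroup_zero[OF G] by blast
    then obtain i where i: "g0 i \<noteq> 0" by (auto simp: fun_eq_iff)
    define H where "H = {h \<in> G. h i = 0}"
    have H: "subgroup H QN"
      using G by (auto simp: H_def subgroup_QN_iff)
    have "QN.subspace {v. v i = 0}"
      by (rule QN.subspaceI) (auto simp: scaleQN_def)
    then have "QN.span H \<subseteq> {v. v i = 0}"
      by (intro QN.span_minimal) (auto simp: H_def)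
    then have "rank_le r H"
      using i g0 by (intro rank_le_decrease[OF Suc.prems(2)]) (auto simp: H_def)
    then obtain F2 where F2: "F2 \<subseteq> H" "finite F2"
      "\<And>h. h \<in> H \<Longrightarrow> \<exists>f\<in>F2. \<exists>x\<in>H. h = f + scaleQN (of_nat N) x"
      using Suc.IH[OF H] by metis
    have "\<exists>F\<subseteq>(\<lambda>g. g i) ` G. finite F \<and>
      (\<forall>a\<in>(\<lambda>g. g i) ` G. \<exists>f\<in>F. \<exists>x\<in>(\<lambda>g. g i) ` G. a = f + of_nat N * x)"
    proof (rule rat_finite_mod)
      show "0 \<in> (\<lambda>g. g i) ` G" using subgroup_zero[OF G] by (intro image_eqI[of _ _ 0]) auto
    next
      fix a b u v assume "a \<in> (\<lambda>g. g i) ` G" "b \<in> (\<lambda>g. g i) ` G"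
      then obtain g h where "g \<in> G" "h \<in> G" "a = g i" "b = h i" by blast
      then show "of_int u * a + of_int v * b \<in> (\<lambda>g. g i) ` G"
        by (intro image_eqI[of _ _ "scaleQN (of_int u) g + scaleQN (of_int v) h"])
          (auto simp: scaleQN_def[of _ _] intro!: subgroup_add[OF G] subgroup_scale_int[OF G, unfolded scaleQN_def])
    qed (rule N)
    then obtain E where E: "E \<subseteq> (\<lambda>g. g i) ` G" "finite E"
      "\<And>g. g \<in> G \<Longrightarrow> \<exists>f\<in>E. \<exists>x\<in>G. g i = f + of_nat N * x i"
      by (auto 4 4)
    obtain F1 where F1: "F1 \<subseteq> G" "finite F1" "E = (\<lambda>g. g i) ` F1"
      using finite_subset_image[OF E(2,1)] by blast
    define F where "F = (\<lambda>(a, b). a + b) ` (F1 \<times> F2)"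
    have "\<exists>f\<in>F. \<exists>x\<in>G. g = f + scaleQN (of_nat N) x" if g: "g \<in> G" for g
    proof -
      obtain f x where f: "f \<in> F1" "x \<in> G" "g i = f i + of_nat N * x i"
        using E(3)[OF g] F1 by blast
      have "g - (f + scaleQN (of_nat N) x) \<in> H"
        unfolding H_def using g f F1
        by (auto simp: scaleQN_def[of _ x]
            intro!: subgroup_diff[OF G] subgroup_add[OF G] subgroup_scale_nat[OF G, unfolded scaleQN_def])
      then obtain f' x' where f': "f' \<in> F2" "x' \<in> H"
        "g - (f + scaleQN (of_nat N) x) = f' + scaleQN (of_nat N) x'"
        using F2(3) by blast
      have "g = (f + f') + scaleQN (of_nat N) (x + x')"
        using f'(3) by (simp add: QN.scale_right_distrib algebra_simps)
      moreover have "f + f' \<in> F" using f f' by (auto simp: F_def)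
      moreover have "x + x' \<in> G" using f f' by (auto simp: H_def intro: subgroup_add[OF G])
      ultimately show ?thesis by blast
    qed
    moreover have "F \<subseteq> G"
      using F1(1) F2(1) by (auto simp: F_def H_def intro!: subgroup_add[OF G])
    moreover have "finite F" using F1(2) F2(2) by (simp add: F_def)
    ultimately show ?thesis by blast
  qed
qed

lemma finite_index_if_contains_multiples:
  assumes G: "subgroup G QN" "finite_rank G" and D: "subgroup D QN" "D \<subseteq> G"
    and N: "(N::nat) > 0" "\<And>g. g \<in> G \<Longrightarrow> scaleQN (of_nat N) g \<in> D"
  shows "finite_index_subgroup D G"
proof -
  obtain r where "rank_le r G" using G(2) finite_rank_iff_rank_le by blast
  then obtain F where F: "finite F"
    "\<And>g. g \<in> G \<Longrightarrow> \<exists>f\<in>F. \<exists>x\<in>G. g = f + scaleQN (of_nat N) x"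
    using finite_mod_multiples[OF G(1) _ N(1)] by metis
  have coset: "D #>\<^bsub>QN\<lparr>carrier := G\<rparr>\<^esub> a = (\<lambda>d. d + a) ` D" for a
    by (auto simp: r_coset_def QN_def)
  have "rcosets\<^bsub>QN\<lparr>carrier := G\<rparr>\<^esub> D \<subseteq> (\<lambda>f. (\<lambda>d. d + f) ` D) ` F"
  proof
    fix C assume "C \<in> rcosets\<^bsub>QN\<lparr>carrier := G\<rparr>\<^esub> D"
    then obtain a where a: "a \<in> G" "C = (\<lambda>d. d + a) ` D"
      unfolding RCOSETS_def coset by auto
    obtain f x where f: "f \<in> F" "x \<in> G" "a = f + scaleQN (of_nat N) x"
      using F(2)[OF a(1)] by blast
    define y where "y = scaleQN (of_nat N) x"
    have y: "y \<in> D" using N(2) f by (simp add: y_def)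
    have "(\<lambda>d. d + a) ` D = (\<lambda>d. d + f) ` D"
    proof (intro equalityI subsetI; elim imageE)
      fix z d assume "z = d + a" "d \<in> D"
      then show "z \<in> (\<lambda>d. d + f) ` D"
        using f y by (intro image_eqI[of _ _ "d + y"]) (auto simp: y_def ac_simps intro: subgroup_add[OF D(1)])
    next
      fix z d assume "z = d + f" "d \<in> D"
      then show "z \<in> (\<lambda>d. d + a) ` D"
        using f y by (intro image_eqI[of _ _ "d - y"]) (auto simp: y_def ac_simps intro: subgroup_diff[OF D(1)])
    qed
    then show "C \<in> (\<lambda>f. (\<lambda>d. d + f) ` D) ` F" using a f by blast
  qed
  then have "finite (rcosets\<^bsub>QN\<lparr>carrier := G\<rparr>\<^esub> D)"
    using F(1) finite_surj by blast
  then show ?thesis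
    unfolding finite_index_subgroup_def using subgroup_restrict[OF G(1) D] by blast
qed

section \<open>Pure subgroups\<close>

text \<open>
  In a torsion-free group the equation \<open>n a = n g\<close> forces \<open>a = g\<close>, so purity means
  closure under division inside \<open>G\<close>.
\<close>

lemma pure_subgroup_iff:
  assumes G: "subgroup G QN"
  shows "pure_subgroup A G \<longleftrightarrow> subgroup A QN \<and> A \<subseteq> G \<and>
    (\<forall>g\<in>G. \<forall>n::nat. n > 0 \<longrightarrow> scaleQN (of_nat n) g \<in> A \<longrightarrow> g \<in> A)"
    (is "?L \<longleftrightarrow> ?R")
proof
  assume L: ?L
  then have A: "subgroup A QN" "A \<subseteq> G"
    using subgroup_unrestrict[OF G] by (auto simp: pure_subgroup_def)
  have "g \<in> A" if g: "g \<in> G" "n > 0" "scaleQN (of_nat n) g \<in> A" for g and n :: nat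
  proof -
    have "scaleQN (of_nat n) g \<in> multiples n A"
      using L g unfolding pure_subgroup_def by (auto simp: multiples_def)
    then show ?thesis using g(2) by (auto simp: multiples_def)
  qed
  with A show ?R by blast
next
  assume R: ?R
  then have "A \<inter> multiples n G = multiples n A" if "n > 0" for n
    using that subgroup_scale_nat[of A] by (auto simp: multiples_def)
  then show ?L
    using R subgroup_restrict[OF G] by (simp add: pure_subgroup_def)
qed

lemma pure_subgroup_trans:
  assumes "subgroup G QN" "pure_subgroup H G" "pure_subgroup A H"
  shows "pure_subgroup A G"
proof -
  have H: "subgroup H QN" using assms(1,2) by (simp add: pure_subgroup_iff)
  show ?thesis
    using assms(2,3) unfolding pure_subgroup_iff[OF assms(1)] pure_subgroup_iff[OF H] by blast
qed

definition purification :: "(nat \<Rightarrow> rat) set \<Rightarrow> (nat \<Rightarrow> rat) set \<Rightarrow> (nat \<Rightarrow> rat) set" where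
  "purification G H = {g \<in> G. \<exists>n::nat. n > 0 \<and> scaleQN (of_nat n) g \<in> H}"

lemma pure_purification:
  assumes G: "subgroup G QN" and H: "subgroup H QN"
  shows "pure_subgroup (purification G H) G"
  unfolding pure_subgroup_iff[OF G]
proof (intro conjI ballI allI impI)
  show "subgroup (purification G H) QN"
    unfolding subgroup_QN_iff
  proof (intro conjI ballI)
    show "0 \<in> purification G H"
      using subgroup_zero[OF G] subgroup_zero[OF H]
      by (auto simp: purification_def intro!: exI[of _ 1])
  next
    fix x y assume "x \<in> purification G H" "y \<in> purification G H"
    then obtain m n :: nat where xy: "x \<in> G" "y \<in> G" "m > 0" "n > 0"
      "scaleQN (of_nat m) x \<in> H" "scaleQN (of_nat n) y \<in> H"
      by (auto simp: purification_def)
    have "scaleQN (of_nat (m * n)) (x + y) =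
        scaleQN (of_nat n) (scaleQN (of_nat m) x) + scaleQN (of_nat m) (scaleQN (of_nat n) y)"
      by (simp add: QN.scale_right_distrib mult.commute)
    also have "\<dots> \<in> H" by (intro subgroup_add[OF H] subgroup_scale_nat[OF H] xy)
    finally show "x + y \<in> purification G H"
      using xy subgroup_add[OF G] unfolding purification_def
      by (auto intro!: exI[of _ "m * n"] simp del: of_nat_mult)
  next
    fix x assume "x \<in> purification G H"
    then show "- x \<in> purification G H"
      using subgroup_uminus[OF G] subgroup_uminus[OF H] by (auto simp: purification_def)
  qed
next
  fix g and n :: nat
  assume "g \<in> G" "n > 0" "scaleQN (of_nat n) g \<in> purification G H"
  then obtain m :: nat where "m > 0" "scaleQN (of_nat (m * n)) g \<in> H"
    by (auto simp: purification_def)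
  then show "g \<in> purification G H"
    using \<open>g \<in> G\<close> \<open>n > 0\<close> unfolding purification_def
    by (auto intro!: exI[of _ "m * n"] simp del: of_nat_mult)
qed (auto simp: purification_def)

lemma purification_Int:
  assumes "subgroup H QN" "subgroup K QN" "H \<inter> K = {0}"
    and x: "x \<in> purification G H" "x \<in> purification G K"
  shows "x = 0"
proof -
  obtain m n :: nat where mn: "m > 0" "n > 0"
    "scaleQN (of_nat m) x \<in> H" "scaleQN (of_nat n) x \<in> K"
    using x by (auto simp: purification_def)
  have "scaleQN (of_nat m) (scaleQN (of_nat n) x) \<in> H \<inter> K"
    using subgroup_scale_nat[OF assms(1) mn(3), of n] subgroup_scale_nat[OF assms(2) mn(4), of m]
    by (simp add: mult.commute)
  then show ?thesis using assms(3) mn(1,2) by simp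
qed

text \<open>
  Quasi-equality gives \<open>m G \<subseteq> H + K\<close> and \<open>n (H + K) \<subseteq> G\<close>.  The second inclusion places \<open>n H\<close> and
  \<open>n K\<close> in the purifications, which are therefore non-zero; with the first one, their
  sum contains \<open>n m G\<close>.
\<close>

lemma pure_splitting:
  assumes G: "subgroup G QN" "finite_rank G" "G \<noteq> {0}"
    and not_si: "\<not> strongly_indecomposable G"
  shows "\<exists>H K. pure_subgroup H G \<and> pure_subgroup K G \<and> H \<noteq> {0} \<and> K \<noteq> {0} \<and> H \<inter> K = {0} \<and>
    (\<exists>N::nat. N > 0 \<and> (\<forall>g\<in>G. \<exists>h\<in>H. \<exists>k\<in>K. scaleQN (of_nat N) g = h + k))"
proof -
  obtain H K where H: "subgroup H QN" "H \<noteq> {0}" and K: "subgroup K QN" "K \<noteq> {0}"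
    and HK: "H \<inter> K = {0}" and qe: "quasi_equal G (H <#>\<^bsub>QN\<^esub> K)"
    using not_si G unfolding strongly_indecomposable_def by blast
  have HK_sum: "H <#>\<^bsub>QN\<^esub> K = {h + k | h k. h \<in> H \<and> k \<in> K}"
    by (auto simp: set_mult_def QN_def)
  obtain m n :: nat where m: "m > 0" "multiples m G \<subseteq> H <#>\<^bsub>QN\<^esub> K"
    and n: "n > 0" "multiples n (H <#>\<^bsub>QN\<^esub> K) \<subseteq> G"
    using qe unfolding quasi_equal_def by blast
  have nH: "scaleQN (of_nat n) h \<in> purification G H" if h: "h \<in> H" for h
  proof -
    have "h + 0 \<in> H <#>\<^bsub>QN\<^esub> K" unfolding HK_sum using h subgroup_zero[OF K(1)] by blast
    then have "scaleQN (of_nat n) h \<in> G" using n by (auto simp: multiples_def)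
    then show ?thesis
      using subgroup_scale_nat[OF H(1) h] by (auto simp: purification_def intro!: exI[of _ 1])
  qed
  have nK: "scaleQN (of_nat n) k \<in> purification G K" if k: "k \<in> K" for k
  proof -
    have "0 + k \<in> H <#>\<^bsub>QN\<^esub> K" unfolding HK_sum using k subgroup_zero[OF H(1)] by blast
    then have "scaleQN (of_nat n) k \<in> G" using n by (auto simp: multiples_def)
    then show ?thesis
      using subgroup_scale_nat[OF K(1) k] by (auto simp: purification_def intro!: exI[of _ 1])
  qed
  have pure: "pure_subgroup (purification G H) G" "pure_subgroup (purification G K) G"
    using pure_purification G H K by blast+
  have nonzero: "purification G H \<noteq> {0}" "purification G K \<noteq> {0}"
  proof -
    obtain h k where "h \<in> H" "h \<noteq> 0" "k \<in> K" "k \<noteq> 0"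
      using H K subgroup_zero by blast
    then have "scaleQN (of_nat n) h \<in> purification G H" "scaleQN (of_nat n) h \<noteq> 0"
      "scaleQN (of_nat n) k \<in> purification G K" "scaleQN (of_nat n) k \<noteq> 0"
      using nH nK n(1) by (simp_all add: QN.scale_eq_0_iff)
    then show "purification G H \<noteq> {0}" "purification G K \<noteq> {0}"
      by (metis singletonD)+
  qed
  have "0 \<in> purification G H" "0 \<in> purification G K"
    using pure subgroup_zero by (auto simp: pure_subgroup_iff[OF G(1)])
  then have int: "purification G H \<inter> purification G K = {0}"
    using purification_Int[OF H(1) K(1) HK] by blast
  have "\<exists>h\<in>purification G H. \<exists>k\<in>purification G K. scaleQN (of_nat (n * m)) g = h + k"
    if g: "g \<in> G" for g
  proof -
    have "scaleQN (of_nat m) g \<in> H <#>\<^bsub>QN\<^esub> K" using m g by (auto simp: multiples_def)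
    then obtain h k where hk: "h \<in> H" "k \<in> K" "scaleQN (of_nat m) g = h + k"
      unfolding HK_sum by blast
    have "scaleQN (of_nat (n * m)) g = scaleQN (of_nat n) (scaleQN (of_nat m) g)" by simp
    also have "\<dots> = scaleQN (of_nat n) h + scaleQN (of_nat n) k"
      by (simp only: hk(3) QN.scale_right_distrib)
    finally show ?thesis using nH[OF hk(1)] nK[OF hk(2)] by blast
  qed
  moreover have "n * m > 0" using m n by simp
  ultimately show ?thesis
    using pure nonzero int
    by (intro exI[of _ "purification G H"] exI[of _ "purification G K"] exI[of _ "n * m"] conjI ballI)
qed

section \<open>Direct sums indexed by initial segments\<close>

definition family_sums :: "nat \<Rightarrow> (nat \<Rightarrow> (nat \<Rightarrow> rat) set) \<Rightarrow> (nat \<Rightarrow> rat) set" where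
  "family_sums k A = {\<Sum>i<k. x i | x. \<forall>i<k. x i \<in> A i}"

text \<open>
  Testing only representations of \<open>0\<close>, by arbitrary functions instead of extensional ones, makes
  concatenation of families easy; by subtraction it is equivalent to unique representation.
\<close>

definition independent_family :: "nat \<Rightarrow> (nat \<Rightarrow> (nat \<Rightarrow> rat) set) \<Rightarrow> bool" where
  "independent_family k A \<longleftrightarrow>
    (\<forall>x. (\<forall>i<k. x i \<in> A i) \<longrightarrow> (\<Sum>i<k. x i) = 0 \<longrightarrow> (\<forall>i<k. x i = 0))"

lemma family_sums_subset:
  assumes "subgroup G QN" "\<And>i. i < k \<Longrightarrow> A i \<subseteq> G"
  shows "family_sums k A \<subseteq> G"
  using assms(2) by (auto simp: family_sums_def intro!: subgroup_sum[OF assms(1)])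

lemma subgroup_family_sums:
  assumes "\<And>i. i < k \<Longrightarrow> subgroup (A i) QN"
  shows "subgroup (family_sums k A) QN"
  unfolding subgroup_QN_iff
proof (intro conjI ballI)
  show "0 \<in> family_sums k A"
    using assms subgroup_zero by (auto simp: family_sums_def intro!: exI[of _ "\<lambda>_. 0"])
next
  fix u v assume "u \<in> family_sums k A" "v \<in> family_sums k A"
  then obtain x y where "u = (\<Sum>i<k. x i)" "v = (\<Sum>i<k. y i)"
    "\<forall>i<k. x i \<in> A i" "\<forall>i<k. y i \<in> A i" by (auto simp: family_sums_def)
  then show "u + v \<in> family_sums k A"
    using assms subgroup_add unfolding family_sums_def
    by (auto intro!: exI[of _ "\<lambda>i. x i + y i"] simp: sum.distrib)
next
  fix u assume "u \<in> family_sums k A"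
  then obtain x where "u = (\<Sum>i<k. x i)" "\<forall>i<k. x i \<in> A i" by (auto simp: family_sums_def)
  then show "- u \<in> family_sums k A"
    using assms subgroup_uminus unfolding family_sums_def
    by (auto intro!: exI[of _ "\<lambda>i. - x i"] simp: sum_negf)
qed

lemma is_direct_sum_family_sums:
  assumes A: "\<And>i. i < k \<Longrightarrow> subgroup (A i) QN" and ind: "independent_family k A"
  shows "is_direct_sum {..<k} A (family_sums k A)"
proof -
  have "inj_on (\<lambda>x. \<Sum>i<k. x i) (\<Pi>\<^sub>E i\<in>{..<k}. A i)"
  proof (rule inj_onI)
    fix x y assume x: "x \<in> (\<Pi>\<^sub>E i\<in>{..<k}. A i)" and y: "y \<in> (\<Pi>\<^sub>E i\<in>{..<k}. A i)"
      and eq: "(\<Sum>i<k. x i) = (\<Sum>i<k. y i)"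
    have "\<forall>i<k. x i - y i \<in> A i" using x y A by (auto intro!: subgroup_diff)
    moreover have "(\<Sum>i<k. x i - y i) = 0" using eq by (simp add: sum_subtractf)
    ultimately have "\<forall>i<k. x i - y i = 0" using ind[unfolded independent_family_def, rule_format, of "\<lambda>i. x i - y i"] by blast
    then show "x = y" using x y by (intro PiE_ext[OF x y]) auto
  qed
  moreover have "(\<lambda>x. \<Sum>i<k. x i) ` (\<Pi>\<^sub>E i\<in>{..<k}. A i) = family_sums k A"
  proof (intro equalityI subsetI)
    fix u assume "u \<in> family_sums k A"
    then obtain x where x: "u = (\<Sum>i<k. x i)" "\<forall>i<k. x i \<in> A i" by (auto simp: family_sums_def)
    then show "u \<in> (\<lambda>x. \<Sum>i<k. x i) ` (\<Pi>\<^sub>E i\<in>{..<k}. A i)"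
      by (intro image_eqI[of _ _ "restrict x {..<k}"]) auto
  qed (auto simp: family_sums_def)
  ultimately show ?thesis using A by (simp add: is_direct_sum_def bij_betw_def)
qed

text \<open>
  Concatenation serves both for families of subgroups and for families of elements chosen from them.
\<close>

definition append_family :: "nat \<Rightarrow> (nat \<Rightarrow> 'a) \<Rightarrow> (nat \<Rightarrow> 'a) \<Rightarrow> nat \<Rightarrow> 'a" where
  "append_family k A B i = (if i < k then A i else B (i - k))"

lemma sum_lessThan_add:
  fixes f :: "nat \<Rightarrow> 'a::comm_monoid_add"
  shows "(\<Sum>i<k + l. f i) = (\<Sum>i<k. f i) + (\<Sum>j<l. f (k + j))"
  by (induction l) (auto simp: add.assoc)

lemma all_less_append_family:
  "(\<forall>i<k + l. P (append_family k A B i)) \<longleftrightarrow> (\<forall>i<k. P (A i)) \<and> (\<forall>j<l. P (B j))"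
proof (intro iffI conjI allI impI)
  assume all: "\<forall>i<k + l. P (append_family k A B i)"
  show "P (A i)" if "i < k" for i using all[rule_format, of i] that by (simp add: append_family_def)
  show "P (B j)" if "j < l" for j using all[rule_format, of "k + j"] that by (simp add: append_family_def)
qed (auto simp: append_family_def)

lemma append_family_sums:
  assumes "a \<in> family_sums k A" "b \<in> family_sums l B"
  shows "a + b \<in> family_sums (k + l) (append_family k A B)"
proof -
  obtain x y where x: "a = (\<Sum>i<k. x i)" "\<forall>i<k. x i \<in> A i"
    and y: "b = (\<Sum>i<l. y i)" "\<forall>i<l. y i \<in> B i"
    using assms by (auto simp: family_sums_def)
  have "a + b = (\<Sum>i<k + l. append_family k x y i)"
    unfolding sum_lessThan_add x y by (simp add: append_family_def)
  moreover have "\<forall>i<k + l. append_family k x y i \<in> append_family k A B i"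
    using x y by (auto simp: append_family_def)
  ultimately show ?thesis unfolding family_sums_def by blast
qed

text \<open>
  In a vanishing sum, the part in \<open>H\<close> is the negative of the part in \<open>K\<close>, so both vanish.
\<close>

lemma independent_append_family:
  assumes H: "subgroup H QN" and K: "subgroup K QN" and HK: "H \<inter> K = {0}"
    and A: "\<And>i. i < k \<Longrightarrow> A i \<subseteq> H" "independent_family k A"
    and B: "\<And>j. j < l \<Longrightarrow> B j \<subseteq> K" "independent_family l B"
  shows "independent_family (k + l) (append_family k A B)"
  unfolding independent_family_def
proof (intro allI impI)
  fix x i assume x: "\<forall>i<k + l. x i \<in> append_family k A B i" "(\<Sum>i<k + l. x i) = 0"
    and i: "i < k + l"
  have xA: "x i \<in> A i" if "i < k" for i
    using x(1)[rule_format, of i] that by (simp add: append_family_def)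
  have xB: "x (k + j) \<in> B j" if "j < l" for j
    using x(1)[rule_format, of "k + j"] that by (simp add: append_family_def)
  define a b where "a = (\<Sum>i<k. x i)" and "b = (\<Sum>j<l. x (k + j))"
  have "a \<in> H" unfolding a_def by (rule subgroup_sum[OF H]) (use xA A(1) in blast)
  moreover have "b \<in> K" unfolding b_def by (rule subgroup_sum[OF K]) (use xB B(1) in blast)
  moreover have "a = - b" using x(2) by (simp add: sum_lessThan_add a_def b_def eq_neg_iff_add_eq_0)
  ultimately have "a \<in> H \<inter> K" using subgroup_uminus[OF K] by simp
  then have "a = 0" using HK by blast
  then have "b = 0" using \<open>a = - b\<close> by simp
  have xA0: "x j = 0" if "j < k" for j
    using A(2)[unfolded independent_family_def, rule_format, of x j, OF xA] \<open>a = 0\<close> that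
    by (simp only: a_def)
  have xB0: "x (k + j) = 0" if "j < l" for j
    using B(2)[unfolded independent_family_def, rule_format, of "\<lambda>j. x (k + j)" j, OF xB]
      \<open>b = 0\<close> that
    by (simp only: b_def)
  show "x i = 0"
  proof (cases "i < k")
    case True
    then show ?thesis by (rule xA0)
  next
    case False
    then show ?thesis using xB0[of "i - k"] i by simp
  qed
qed

section \<open>The decomposition\<close>

text \<open>
  If \<open>M H\<close> and \<open>L K\<close> lie in the sums found for the pure summands \<open>H\<close> and \<open>K\<close>, and \<open>N G \<subseteq> H + K\<close>,
  then \<open>M L N G\<close> lies in the sum of the concatenated family.  The zero group is the sum of the empty
  family.
\<close>

lemma quasi_decomposition:
  assumes "subgroup G QN" "rank_le r G"
  shows "\<exists>k A. \<exists>N::nat. N > 0 \<and> independent_family k A \<and>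
    (\<forall>i<k. strongly_indecomposable (A i) \<and> pure_subgroup (A i) G) \<and>
    (\<forall>g\<in>G. scaleQN (of_nat N) g \<in> family_sums k A)"
  using assms
proof (induction r arbitrary: G)
  case 0
  then have "\<forall>g\<in>G. g = 0" using rank_le_0 by blast
  then show ?case
    by (intro exI[of _ 0] exI[of _ "\<lambda>_. {}"] exI[of _ 1])
      (auto simp: independent_family_def family_sums_def)
next
  case (Suc r)
  note G = \<open>subgroup G QN\<close>
  have fin: "finite_rank G" using Suc.prems finite_rank_iff_rank_le by blast
  consider "G = {0}" | "strongly_indecomposable G" | "G \<noteq> {0}" "\<not> strongly_indecomposable G"
    by blast
  then show ?case
  proof cases
    case 1
    then show ?thesis
      by (intro exI[of _ 0] exI[of _ "\<lambda>_. {}"] exI[of _ 1])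
        (auto simp: independent_family_def family_sums_def)
  next
    case 2
    have "pure_subgroup G G" using pure_subgroup_iff[OF G] G by blast
    then show ?thesis using 2
      by (intro exI[of _ 1] exI[of _ "\<lambda>_. G"] exI[of _ 1])
        (auto simp: independent_family_def family_sums_def intro: exI[of _ "\<lambda>_. _"])
  next
    case 3
    then obtain H K and N :: nat where
      pH: "pure_subgroup H G" "H \<noteq> {0}" and pK: "pure_subgroup K G" "K \<noteq> {0}"
      and HK: "H \<inter> K = {0}" and N: "N > 0"
      "\<And>g. g \<in> G \<Longrightarrow> \<exists>h\<in>H. \<exists>k\<in>K. scaleQN (of_nat N) g = h + k"
      using pure_splitting[OF G fin] by metis
    have H: "subgroup H QN" "H \<subseteq> G" and K: "subgroup K QN" "K \<subseteq> G"
      using pH pK by (auto simp: pure_subgroup_iff[OF G])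
    have drop: "rank_le r X" if X: "subgroup X QN" "X \<subseteq> G" and Y: "subgroup Y QN" "Y \<subseteq> G" "Y \<noteq> {0}"
      and XY: "X \<inter> Y = {0}" for X Y
    proof -
      obtain y where y: "y \<in> Y" "y \<noteq> 0" using Y subgroup_zero by blast
      have "y \<notin> QN.span X"
      proof
        assume "y \<in> QN.span X"
        then obtain n :: nat where "n > 0" "scaleQN (of_nat n) y \<in> X"
          using span_multiple_in_subgroup[OF X(1)] by blast
        moreover have "scaleQN (of_nat n) y \<in> Y" using subgroup_scale_nat[OF Y(1) y(1)] .
        ultimately have "scaleQN (of_nat n) y = 0" using XY by blast
        then show False using \<open>n > 0\<close> y by simp
      qed
      then show ?thesis using rank_le_decrease[OF Suc.prems(2) X(2)] y Y by blast
    qed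
    obtain k A and M :: nat where A: "M > 0" "independent_family k A"
      "\<And>i. i < k \<Longrightarrow> strongly_indecomposable (A i) \<and> pure_subgroup (A i) H"
      "\<And>h. h \<in> H \<Longrightarrow> scaleQN (of_nat M) h \<in> family_sums k A"
      using Suc.IH[OF H(1) drop[OF H K pK(2) HK]] by metis
    obtain l B and L :: nat where B: "L > 0" "independent_family l B"
      "\<And>i. i < l \<Longrightarrow> strongly_indecomposable (B i) \<and> pure_subgroup (B i) K"
      "\<And>h. h \<in> K \<Longrightarrow> scaleQN (of_nat L) h \<in> family_sums l B"
      using Suc.IH[OF K(1) drop[OF K H pH(2)]] HK by (metis inf_commute)
    have AH: "A i \<subseteq> H" "subgroup (A i) QN" "pure_subgroup (A i) G" if "i < k" for i
      using A(3)[OF that] pure_subgroup_iff[OF H(1)] pure_subgroup_trans[OF G pH(1)] by auto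
    have BK: "B i \<subseteq> K" "subgroup (B i) QN" "pure_subgroup (B i) G" if "i < l" for i
      using B(3)[OF that] pure_subgroup_iff[OF K(1)] pure_subgroup_trans[OF G pK(1)] by auto
    have "independent_family (k + l) (append_family k A B)"
      using independent_append_family[OF H(1) K(1) HK AH(1) A(2) BK(1) B(2)] .
    moreover have "\<forall>i<k + l. strongly_indecomposable (append_family k A B i) \<and>
        pure_subgroup (append_family k A B i) G"
      unfolding all_less_append_family[where P = "\<lambda>X. strongly_indecomposable X \<and> pure_subgroup X G"]
      using A(3) B(3) AH(3) BK(3) by blast
    moreover have "scaleQN (of_nat (M * L * N)) g \<in> family_sums (k + l) (append_family k A B)"
      if g: "g \<in> G" for g
    proof -
      obtain h c where hc: "h \<in> H" "c \<in> K" "scaleQN (of_nat N) g = h + c"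
        using N(2)[OF g] by blast
      have "scaleQN (of_nat (M * L * N)) g = scaleQN (of_nat (M * L)) (scaleQN (of_nat N) g)"
        by simp
      also have "\<dots> = scaleQN (of_nat L) (scaleQN (of_nat M) h) + scaleQN (of_nat M) (scaleQN (of_nat L) c)"
        by (simp add: hc(3) QN.scale_right_distrib mult.commute)
      also have "\<dots> \<in> family_sums (k + l) (append_family k A B)"
        using subgroup_scale_nat[OF subgroup_family_sums[OF AH(2)] A(4)[OF hc(1)]]
          subgroup_scale_nat[OF subgroup_family_sums[OF BK(2)] B(4)[OF hc(2)]]
        by (intro append_family_sums) auto
      finally show ?thesis .
    qed
    moreover have "M * L * N > 0" using A(1) B(1) N(1) by simp
    ultimately show ?thesis by blast
  qed
qed

theorem mainTheorem2:
  fixes G :: "(nat \<Rightarrow> rat) set"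
  assumes "subgroup G QN" and "finite_rank G"
  shows "\<exists>D (k::nat) (A :: nat \<Rightarrow> (nat \<Rightarrow> rat) set).
           finite_index_subgroup D G \<and>
           is_direct_sum {..<k} A D \<and>
           (\<forall>i<k. strongly_indecomposable (A i) \<and> pure_subgroup (A i) G)"
proof -
  obtain r where "rank_le r G" using assms(2) finite_rank_iff_rank_le by blast
  then obtain k A and N :: nat where N: "N > 0" and ind: "independent_family k A"
    and A: "\<And>i. i < k \<Longrightarrow> strongly_indecomposable (A i) \<and> pure_subgroup (A i) G"
    and NG: "\<And>g. g \<in> G \<Longrightarrow> scaleQN (of_nat N) g \<in> family_sums k A"
    using quasi_decomposition[OF assms(1)] by metis
  have sub: "subgroup (A i) QN" "A i \<subseteq> G" if "i < k" for i
    using A[OF that] by (auto simp: pure_subgroup_iff[OF assms(1)])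
  have "finite_index_subgroup (family_sums k A) G"
    using finite_index_if_contains_multiples[OF assms subgroup_family_sums family_sums_subset[OF assms(1)] N NG]
      sub by blast
  moreover have "is_direct_sum {..<k} A (family_sums k A)"
    using is_direct_sum_family_sums[OF sub(1) ind] .
  ultimately show ?thesis using A by blast
qed

end
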